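(* If there is a Michael ultrafilter, then there is a Michael space.
   Context: A Michael space is a Lindelöf space whose product with the Baire space $\omega^\omega$ is not Lindelöf. All ultrafilters are non-principal ultrafilters on $\omega$. For an ultrafilter $\mathscr{U}$ and $f,g\in\omega^\omega$, $f\leq_{\mathscr{U}} g$ means $\{n\in\omega : f(n)\leq g(n)\}\in\mathscr{U}$. For $K\subseteq\omega^\omega$, $\mathrm{cof}(K/\mathscr{U})$ is the least cardinality of a set $D\subseteq K$ such that for every $f\in K$ there is $g\in D$ with $f\leq_{\mathscr{U}} g$. $\mathscr{U}$ is a Michael ultrafilter if for every compact $K\subseteq\omega^\omega$, if $\mathrm{cof}(K/\mathscr{U})>\omega$ then $\mathrm{cof}(K/\mathscr{U})\geq\mathrm{cof}(\omega^\omega/\mathscr{U})$. *)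

theory Defs
  imports "HOL-Analysis.Analysis"
begin

unbundle cardinal_syntax

definition baire_space :: "(nat \<Rightarrow> nat) topology" where
  "baire_space = product_topology (\<lambda>_. discrete_topology UNIV) UNIV"

text \<open>A space is a topology on a subset \<open>topspace X\<close> of a type; points can be taken from
  \<open>(nat \<Rightarrow> nat) set\<close> without loss for spaces of cardinality at most \<open>2^(2^\<omega>)\<close>. No separation
  axiom is part of the definition.\<close>

definition michael_space :: "'a topology \<Rightarrow> bool" where
  "michael_space X \<longleftrightarrow>
     Lindelof_space X \<and> \<not> Lindelof_space (prod_topology X baire_space)"

text \<open>An ultrafilter \<open>\<U>\<close> on \<open>\<omega>\<close> is represented by the filter \<open>U\<close> with
  \<open>{n. P n} \<in> \<U>\<close> iff \<open>eventually P U\<close>. Since \<open>bot\<close> is a filter in the library,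
  properness is required explicitly.\<close>

definition nonprincipal_ultrafilter :: "nat filter \<Rightarrow> bool" where
  "nonprincipal_ultrafilter U \<longleftrightarrow>
     U \<noteq> bot \<and>
     (\<forall>P. eventually P U \<or> eventually (\<lambda>n. \<not> P n) U) \<and>
     (\<forall>n. U \<noteq> principal {n})"

definition le_mod :: "nat filter \<Rightarrow> (nat \<Rightarrow> nat) \<Rightarrow> (nat \<Rightarrow> nat) \<Rightarrow> bool" where
  "le_mod U f g \<longleftrightarrow> eventually (\<lambda>n. f n \<le> g n) U"

definition cofinal_mod :: "nat filter \<Rightarrow> (nat \<Rightarrow> nat) set \<Rightarrow> (nat \<Rightarrow> nat) set \<Rightarrow> bool" where
  "cofinal_mod U K D \<longleftrightarrow> D \<subseteq> K \<and> (\<forall>f\<in>K. \<exists>g\<in>D. le_mod U f g)"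

text \<open>The cardinal \<open>cof(K/U)\<close>, represented (as usual for HOL cardinals, up to \<open>=o\<close>) by
  the cardinal order \<open>|D|\<close> of a cofinal set \<open>D\<close> of least cardinality. The facts
  \<open>cof_attained\<close> and \<open>cof_least\<close> show that the choice is well defined.\<close>

definition cof :: "nat filter \<Rightarrow> (nat \<Rightarrow> nat) set \<Rightarrow> (nat \<Rightarrow> nat) rel" where
  "cof U K = |SOME D. cofinal_mod U K D \<and> (\<forall>D'. cofinal_mod U K D' \<longrightarrow> |D| \<le>o |D'| )|"

lemma ex_least_cofinal_mod:
  "\<exists>D. cofinal_mod U K D \<and> (\<forall>D'. cofinal_mod U K D' \<longrightarrow> |D| \<le>o |D'| )"
proof -
  let ?R = "card_of ` {D. cofinal_mod U K D}"
  have "cofinal_mod U K K"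
    unfolding cofinal_mod_def le_mod_def by (auto intro!: bexI always_eventually)
  then have "?R \<noteq> {}" by blast
  moreover have "\<forall>r\<in>?R. Card_order r"
    using card_of_Card_order by blast
  ultimately have "\<exists>r\<in>?R. \<forall>r'\<in>?R. r \<le>o r'"
    by (rule exists_minim_Card_order)
  then show ?thesis by auto
qed

lemma cof_attained: "\<exists>D. cofinal_mod U K D \<and> cof U K = |D|"
  unfolding cof_def using someI_ex[OF ex_least_cofinal_mod] by blast

lemma cof_least: "cofinal_mod U K D \<Longrightarrow> cof U K \<le>o |D|"
  unfolding cof_def using someI_ex[OF ex_least_cofinal_mod] by blast

definition michael_ultrafilter :: "nat filter \<Rightarrow> bool" where
  "michael_ultrafilter U \<longleftrightarrow>
     nonprincipal_ultrafilter U \<and>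
     (\<forall>K. compactin baire_space K \<and> natLeq <o cof U K \<longrightarrow> cof U UNIV \<le>o cof U K)"

end

theory Submission
  imports Defs "HOL-Library.Countable_Set_Type"
begin

text \<open>
  Let \<open>U\<close> be a Michael ultrafilter, \<open>D\<close> a least cofinal set of \<open>\<omega>\<^sup>\<omega>/U\<close>, well-ordered in
  the type of its cardinal \<open>\<kappa>\<close>. The sets \<open>X \<xi>\<close> of functions bounded modulo \<open>U\<close> by a member
  of \<open>D\<close> before \<open>\<xi>\<close> increase with \<open>\<xi>\<close> and are proper, since fewer than \<open>\<kappa>\<close> functions are
  not cofinal. Together with \<open>\<omega>\<^sup>\<omega>\<close> itself they form a well-ordered chain \<open>\<L>\<close> of levels.

  The hypothesis on \<open>U\<close> says what compact sets do in this chain: a compact \<open>K\<close> contained in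
  a level \<open>L\<close> lies in a strictly smaller level, unless the levels below \<open>L\<close> have countable
  cofinality. For let \<open>K \<subseteq> X \<xi>\<close> be in no smaller level, and let the levels below have
  uncountable cofinality. If \<open>cof(K/U)\<close> were countable, the levels containing the members of a
  countable cofinal set would stay below a level smaller than \<open>X \<xi>\<close>, and that level would
  contain \<open>K\<close>. So \<open>cof(K/U) \<ge> \<kappa>\<close>. But no member of \<open>D\<close> before \<open>\<xi>\<close> bounds \<open>K\<close>, so
  each of them is bounded by a member of \<open>K\<close>, and these members are cofinal in \<open>K\<close>: there
  are fewer than \<open>\<kappa>\<close> of them. The top level needs only that \<open>K\<close> is bounded. This is
  \<open>michael_chain_of_ultrafilter\<close>.

  From such a chain the space is made of the pairs \<open>(z, L)\<close> of a point \<open>z\<close> of the compact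
  second countable space \<open>(\<omega>+1)\<^sup>\<omega>\<close> and a level \<open>L\<close> not containing \<open>z\<close>; a neighbourhood of \<open>(z,
  L)\<close> contains all points of level at most \<open>L\<close> over some neighbourhood of \<open>z\<close>. It is Lindelof
  by induction on the level: countably many such boxes cover the points of level \<open>L\<close>, what
  they miss of the lower levels lies over a compact subset of \<open>L\<close>, and by the property of
  compact sets this leaves one lower level or countably many. Its product with \<open>\<omega>\<^sup>\<omega>\<close> is not
  Lindelof: the closed set of the points \<open>((f, L), f)\<close> meets every level except \<open>\<omega>\<^sup>\<omega>\<close>, and a
  countable cover of it by initial segments of levels would make these levels have countable
  cofinality, which they have not because countably many functions are always bounded modulo
  \<open>U\<close>.
\<close>

section \<open>From a chain of sets of functions to a Michael space\<close>

text \<open>Countable cofinality of the strict predecessors of \<open>L\<close>. No predecessor, or a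
  greatest one, counts as countable cofinality: in a well-ordered chain only limits of
  uncountable cofinality fail it.\<close>

definition countably_approached :: "'a set set \<Rightarrow> 'a set \<Rightarrow> bool" where
  "countably_approached \<L> L \<longleftrightarrow>
     (\<exists>\<C>. \<C> \<subseteq> {L'\<in>\<L>. L' \<subset> L} \<and> countable \<C> \<and> (\<forall>L'\<in>\<L>. L' \<subset> L \<longrightarrow> (\<exists>C\<in>\<C>. L' \<subseteq> C)))"

text \<open>The only members of the chain that compact sets can exhaust are those of countable
  cofinality. The top member is not one of these, so every compact set lies in a proper member.\<close>

locale michael_chain =
  fixes \<L> :: "(nat \<Rightarrow> nat) set set"
  assumes UNIV_in: "UNIV \<in> \<L>"
    and least: "A \<subseteq> \<L> \<Longrightarrow> A \<noteq> {} \<Longrightarrow> \<exists>L\<in>A. \<forall>L'\<in>A. L \<subseteq> L'"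
    and compact_below: "L \<in> \<L> \<Longrightarrow> compactin baire_space K \<Longrightarrow> K \<subseteq> L \<Longrightarrow>
      (\<exists>L'\<in>\<L>. L' \<subset> L \<and> K \<subseteq> L') \<or> countably_approached \<L> L"
    and not_approached: "\<not> countably_approached \<L> UNIV"

text \<open>The copy of the Baire space inside the compact space \<open>(\<omega>+1)\<^sup>\<omega>\<close>.\<close>

definition emb :: "(nat \<Rightarrow> nat) \<Rightarrow> nat \<Rightarrow> enat" where
  "emb f = (\<lambda>n. enat (f n))"

text \<open>This topology makes an initial segment of levels open and at the same time puts all
  levels below \<open>L\<close> into each neighbourhood of \<open>L\<close>. The first makes the product with the Baire
  space fail to be Lindelof, the second keeps the space itself Lindelof.\<close>

definition down_topology :: "'a set topology" where
  "down_topology = topology (\<lambda>S. \<forall>L\<in>S. \<forall>L'\<subseteq>L. L' \<in> S)"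

definition chain_space :: "(nat \<Rightarrow> nat) set set \<Rightarrow> ((nat \<Rightarrow> enat) \<times> (nat \<Rightarrow> nat) set) topology" where
  "chain_space \<L> = subtopology (prod_topology euclidean down_topology)
     {(z, L). L \<in> \<L> \<and> z \<notin> emb ` L}"

lemma openin_down_topology: "openin down_topology S \<longleftrightarrow> (\<forall>L\<in>S. \<forall>L'\<subseteq>L. L' \<in> S)"
proof -
  have "istopology (\<lambda>S. \<forall>L\<in>S. \<forall>L'\<subseteq>(L::'a set). L' \<in> S)"
    unfolding istopology_def by blast
  then show ?thesis
    by (simp add: down_topology_def)
qed

lemma topspace_down_topology [simp]: "topspace down_topology = UNIV"
  using openin_subset[of down_topology UNIV] by (simp add: openin_down_topology top.extremum_unique)

lemma topspace_baire_space [simp]: "topspace baire_space = UNIV"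
  by (simp add: baire_space_def)

lemma topspace_chain_space [simp]:
  "topspace (chain_space \<L>) = {(z, L). L \<in> \<L> \<and> z \<notin> emb ` L}"
  by (simp add: chain_space_def)

lemma emb_eq_iff [simp]: "emb f = emb g \<longleftrightarrow> f = g"
  by (auto simp: emb_def fun_eq_iff)

lemma continuous_map_emb: "continuous_map baire_space euclidean emb"
proof -
  have "continuous_map baire_space (product_topology (\<lambda>_. euclidean) UNIV) emb"
    unfolding continuous_map_componentwise_UNIV
  proof
    fix n
    have 1: "continuous_map baire_space (discrete_topology UNIV) (\<lambda>f. f n)"
      unfolding baire_space_def by (rule continuous_map_product_projection) simp
    have 2: "continuous_map (discrete_topology UNIV) euclidean enat"
      by simp
    show "continuous_map baire_space euclidean (\<lambda>f. emb f n)"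
      using continuous_map_compose[OF 1 2] by (simp add: comp_def emb_def)
  qed
  then show ?thesis
    by (simp add: euclidean_product_topology)
qed

text \<open>Compactness has to be brought back from \<open>(\<omega>+1)\<^sup>\<omega>\<close> to the Baire space: the inverse of the
  embedding is continuous on \<open>C\<close>, because finite points of \<open>\<omega>+1\<close> are isolated.\<close>

lemma compactin_emb_vimage:
  assumes "closed C" and "C \<subseteq> range emb"
  shows "compactin baire_space (emb -` C)"
proof -
  have "compact (UNIV :: (nat \<Rightarrow> enat) set)"
  proof -
    have "compact_space (euclidean :: enat topology)"
      by (simp add: compact_space_def compactin_euclidean_iff compact_UNIV)
    then have "compact_space (product_topology (\<lambda>_::nat. euclidean :: enat topology) UNIV)"
      by (simp add: compact_space_product_topology)
    then show ?thesis
      by (simp add: euclidean_product_topology compact_space_def)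
  qed
  then have "compact C"
    using assms(1) closed_Int_compact[of C UNIV] by simp
  then have cC: "compactin (top_of_set C) C"
    by (simp add: compactin_subtopology)
  define inv where "inv = (\<lambda>(z :: nat \<Rightarrow> enat) n. the_enat (z n))"
  have "continuous_map (top_of_set C) (product_topology (\<lambda>_. discrete_topology UNIV) UNIV) inv"
    unfolding continuous_map_componentwise_UNIV
  proof
    fix n
    have "openin (top_of_set C) {z \<in> C. inv z n \<in> S}" for S
    proof -
      have eq: "{z \<in> C. inv z n \<in> S} = C \<inter> (\<lambda>z. z n) -` (enat ` S)"
        using assms(2) by (auto simp: inv_def emb_def image_iff)
      have "open (enat ` S)"
        by (auto simp: open_enat_iff)
      then have "open ((\<lambda>z::nat\<Rightarrow>enat. z n) -` (enat ` S))"
        by (intro open_vimage) (auto intro: continuous_on_product_coordinates)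
      then show ?thesis
        unfolding eq by blast
    qed
    then show "continuous_map (top_of_set C) (discrete_topology UNIV) (\<lambda>z. inv z n)"
      by (simp add: continuous_map_def)
  qed
  then have "continuous_map (top_of_set C) baire_space inv"
    by (simp add: baire_space_def)
  then have "compactin baire_space (inv ` C)"
    using cC image_compactin by blast
  moreover have "inv ` C = emb -` C"
  proof -
    have inv_emb: "inv (emb f) = f" for f
      by (simp add: inv_def emb_def)
    have "C = emb ` (emb -` C)"
      using assms(2) by blast
    then have "inv ` C = inv ` emb ` (emb -` C)"
      by simp
    also have "\<dots> = emb -` C"
      by (simp only: image_image inv_emb image_ident)
    finally show ?thesis .
  qed
  ultimately show ?thesis
    by simp
qed

lemma openin_chain_space_box:
  assumes "openin (chain_space \<L>) S" and "(z, L) \<in> S"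
  obtains W where "open W" and "z \<in> W"
    and "\<And>w L'. w \<in> W \<Longrightarrow> L' \<in> \<L> \<Longrightarrow> L' \<subseteq> L \<Longrightarrow> w \<notin> emb ` L' \<Longrightarrow> (w, L') \<in> S"
proof -
  from assms(1) obtain T where T: "openin (prod_topology euclidean down_topology) T"
    and S: "S = T \<inter> {(z, L). L \<in> \<L> \<and> z \<notin> emb ` L}"
    unfolding chain_space_def openin_subtopology by blast
  from S assms(2) have "(z, L) \<in> T"
    by blast
  then obtain W V where WV: "openin euclidean W" "openin down_topology V" "z \<in> W" "L \<in> V"
      "W \<times> V \<subseteq> T"
    using iffD1[OF openin_prod_topology_alt T] by meson
  show thesis
  proof (rule that)
    show "open W" "z \<in> W"
      using WV by auto
    show "(w, L') \<in> S" if "w \<in> W" "L' \<in> \<L>" "L' \<subseteq> L" "w \<notin> emb ` L'" for w L'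
      using that WV by (auto simp: S openin_down_topology)
  qed
qed

text \<open>Induction on the level \<open>M\<close> shows that the points of levels up to \<open>M\<close> have a countable
  subcover; the top level gives the whole space. At level \<open>M\<close>, boxes over open sets \<open>W\<close>
  suffice to cover the points \<open>(z, M)\<close>, and \<open>(\<omega>+1)\<^sup>\<omega>\<close> is second countable, so countably
  many of these suffice. The set \<open>C\<close> of all \<open>z\<close> outside them is compact and consists of
  functions in \<open>M\<close>. If \<open>C\<close> lies in a smaller level \<open>L'\<close>, the uncovered points \<open>(z, L)\<close> have
  \<open>z \<in> L' - L\<close> and hence \<open>L \<subset> L'\<close>; otherwise all levels below \<open>M\<close> are below countably many.\<close>

lemma (in michael_chain) Lindelof_space_chain_space: "Lindelof_space (chain_space \<L>)"
  unfolding Lindelof_space_def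
proof (intro allI impI)
  fix \<U>
  assume "(\<forall>U\<in>\<U>. openin (chain_space \<L>) U) \<and> \<Union>\<U> = topspace (chain_space \<L>)"
  then have op: "\<And>U. U \<in> \<U> \<Longrightarrow> openin (chain_space \<L>) U"
    and cov: "\<Union>\<U> = {(z, L). L \<in> \<L> \<and> z \<notin> emb ` L}"
    by auto
  have chain: "L \<subseteq> L' \<or> L' \<subseteq> L" if "L \<in> \<L>" "L' \<in> \<L>" for L L'
    using least[of "{L, L'}"] that by simp
  define upto where "upto = (\<lambda>M. {(z, L). L \<in> \<L> \<and> L \<subseteq> M \<and> z \<notin> emb ` L})"
  define small where "small = (\<lambda>S. \<exists>\<V>. countable \<V> \<and> \<V> \<subseteq> \<U> \<and> S \<subseteq> \<Union>\<V>)"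
  have small_mono: "small S" if "small T" "S \<subseteq> T" for S T
    using that unfolding small_def by (meson order_trans)
  have small_UN: "small (\<Union>i\<in>I. S i)" if "countable I" "\<And>i. i \<in> I \<Longrightarrow> small (S i)"
    for I :: "(nat \<Rightarrow> nat) set set" and S
  proof -
    from that(2) obtain \<V> where
      V: "\<And>i. i \<in> I \<Longrightarrow> countable (\<V> i)" "\<And>i. i \<in> I \<Longrightarrow> \<V> i \<subseteq> \<U>" "\<And>i. i \<in> I \<Longrightarrow> S i \<subseteq> \<Union>(\<V> i)"
      unfolding small_def by metis
    show ?thesis
      unfolding small_def
    proof (intro exI conjI)
      show "countable (\<Union>i\<in>I. \<V> i)"
        using that(1) V(1) by (rule countable_UN)
      show "(\<Union>i\<in>I. \<V> i) \<subseteq> \<U>"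
        using V(2) by (rule UN_least)
      show "(\<Union>i\<in>I. S i) \<subseteq> \<Union>(\<Union>i\<in>I. \<V> i)"
        using V(3) by blast
    qed
  qed
  have small_Un: "small (S \<union> T)" if "small S" "small T" for S T
  proof -
    from that obtain \<V> \<W> where "countable \<V>" "\<V> \<subseteq> \<U>" "S \<subseteq> \<Union>\<V>" "countable \<W>" "\<W> \<subseteq> \<U>" "T \<subseteq> \<Union>\<W>"
      unfolding small_def by blast
    then show ?thesis
      unfolding small_def by (intro exI[of _ "\<V> \<union> \<W>"]) auto
  qed
  have small_upto: "small (upto M)"
    if M: "M \<in> \<L>" and IH: "\<And>L. L \<in> \<L> \<Longrightarrow> L \<subset> M \<Longrightarrow> small (upto L)" for M
  proof -
    define box where "box = (\<lambda>W U. \<forall>w L'. w \<in> W \<longrightarrow> L' \<in> \<L> \<longrightarrow> L' \<subseteq> M \<longrightarrow> w \<notin> emb ` L' \<longrightarrow> (w, L') \<in> U)"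
    define \<F> where "\<F> = {W. open W \<and> (\<exists>U\<in>\<U>. box W U)}"
    have F_cov: "z \<in> \<Union>\<F>" if "z \<notin> emb ` M" for z
    proof -
      have "(z, M) \<in> \<Union>\<U>"
        using that M cov by blast
      then obtain U where U: "U \<in> \<U>" "(z, M) \<in> U"
        by blast
      obtain W where "open W" "z \<in> W"
        "\<And>w L'. w \<in> W \<Longrightarrow> L' \<in> \<L> \<Longrightarrow> L' \<subseteq> M \<Longrightarrow> w \<notin> emb ` L' \<Longrightarrow> (w, L') \<in> U"
        using openin_chain_space_box[OF op[OF U(1)] U(2)] by metis
      then show ?thesis
        unfolding \<F>_def box_def using U(1) by blast
    qed
    obtain \<G> where G: "\<G> \<subseteq> \<F>" "countable \<G>" "\<Union>\<G> = \<Union>\<F>"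
      using Lindelof[of \<F>] unfolding \<F>_def by blast
    have "\<forall>W\<in>\<G>. \<exists>U\<in>\<U>. box W U"
      using G(1) unfolding \<F>_def by blast
    then obtain u where u: "\<And>W. W \<in> \<G> \<Longrightarrow> u W \<in> \<U> \<and> box W (u W)"
      by metis
    have sW: "small {(z, L). L \<in> \<L> \<and> L \<subseteq> M \<and> z \<notin> emb ` L \<and> z \<in> \<Union>\<G>}"
      unfolding small_def
    proof (intro exI conjI)
      show "countable (u ` \<G>)" "u ` \<G> \<subseteq> \<U>"
        using G(2) u by auto
      show "{(z, L). L \<in> \<L> \<and> L \<subseteq> M \<and> z \<notin> emb ` L \<and> z \<in> \<Union>\<G>} \<subseteq> \<Union>(u ` \<G>)"
        using u unfolding box_def by blast
    qed
    define C where "C = - \<Union>\<G>"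
    have "closed C"
      using G(1) unfolding C_def \<F>_def by auto
    moreover have C_sub: "C \<subseteq> emb ` M"
      using F_cov G(3) unfolding C_def by blast
    ultimately have "compactin baire_space (emb -` C)"
      by (intro compactin_emb_vimage) auto
    moreover have "emb -` C \<subseteq> M"
      using C_sub by auto
    ultimately have "(\<exists>L'\<in>\<L>. L' \<subset> M \<and> emb -` C \<subseteq> L') \<or> countably_approached \<L> M"
      by (rule compact_below[OF M])
    then show ?thesis
    proof
      assume "\<exists>L'\<in>\<L>. L' \<subset> M \<and> emb -` C \<subseteq> L'"
      then obtain L' where 1: "L' \<in> \<L>" "L' \<subset> M" "emb -` C \<subseteq> L'"
        by blast
      have "upto M \<subseteq> {(z, L). L \<in> \<L> \<and> L \<subseteq> M \<and> z \<notin> emb ` L \<and> z \<in> \<Union>\<G>} \<union> upto L'"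
      proof clarify
        fix z L
        assume zL: "(z, L) \<in> upto M" and "(z, L) \<notin> upto L'"
        then have "L \<in> \<L>" "z \<notin> emb ` L" "\<not> L \<subseteq> L'"
          by (auto simp: upto_def)
        \<comment> \<open>By comparability \<open>L' \<subseteq> L\<close>, and \<open>L\<close> does not contain \<open>z\<close>.\<close>
        then have "z \<notin> emb ` L'"
          using chain[of L L'] 1(1) by blast
        then have "z \<notin> C"
          using 1(3) C_sub by blast
        then show "L \<in> \<L> \<and> L \<subseteq> M \<and> z \<notin> emb ` L \<and> z \<in> \<Union>\<G>"
          using zL by (auto simp: C_def upto_def)
      qed
      then show ?thesis
        using small_Un[OF sW IH[OF 1(1,2)]] small_mono by blast
    next
      assume "countably_approached \<L> M"
      then obtain \<C> where 2: "\<C> \<subseteq> {L\<in>\<L>. L \<subset> M}" "countable \<C>"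
          "\<forall>L'\<in>\<L>. L' \<subset> M \<longrightarrow> (\<exists>C\<in>\<C>. L' \<subseteq> C)"
        unfolding countably_approached_def by (elim exE conjE)
      have "upto M \<subseteq> {(z, L). L \<in> \<L> \<and> L \<subseteq> M \<and> z \<notin> emb ` L \<and> z \<in> \<Union>\<G>} \<union> (\<Union>L\<in>\<C>. upto L)"
      proof clarify
        fix z L
        assume zL: "(z, L) \<in> upto M" and *: "(z, L) \<notin> (\<Union>L\<in>\<C>. upto L)"
        then have L: "L \<in> \<L>" "z \<notin> emb ` L" "L \<subseteq> M"
          by (auto simp: upto_def)
        \<comment> \<open>Every level strictly below \<open>M\<close> is contained in one of \<open>\<C>\<close>.\<close>
        have "L = M"
          using * L 2(3) by (auto simp: upto_def)
        then have "z \<in> \<Union>\<G>"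
          using L(2) F_cov[of z] G(3) by simp
        then show "L \<in> \<L> \<and> L \<subseteq> M \<and> z \<notin> emb ` L \<and> z \<in> \<Union>\<G>"
          using L by blast
      qed
      moreover have "small (\<Union>L\<in>\<C>. upto L)"
        using 2(1,2) IH by (intro small_UN) auto
      ultimately show ?thesis
        using small_Un[OF sW] small_mono by blast
    qed
  qed
  have "small (upto M)" if "M \<in> \<L>" for M
  proof (rule ccontr)
    define bad where "bad = {L \<in> \<L>. \<not> small (upto L)}"
    assume "\<not> small (upto M)"
    then have "bad \<subseteq> \<L>" "bad \<noteq> {}"
      using that by (auto simp: bad_def)
    from least[OF this] obtain L where L: "L \<in> bad" "\<forall>L'\<in>bad. L \<subseteq> L'"
      by blast
    have "small (upto L)"
    proof (rule small_upto)
      show "L \<in> \<L>"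
        using L(1) by (simp add: bad_def)
      show "small (upto L')" if "L' \<in> \<L>" "L' \<subset> L" for L'
        using L(2) that by (auto simp: bad_def)
    qed
    then show False
      using L(1) by (simp add: bad_def)
  qed
  from this[OF UNIV_in] obtain \<V> where "countable \<V>" "\<V> \<subseteq> \<U>" "upto UNIV \<subseteq> \<Union>\<V>"
    unfolding small_def by blast
  moreover have "\<Union>\<V> = topspace (chain_space \<L>)"
  proof
    show "\<Union>\<V> \<subseteq> topspace (chain_space \<L>)"
      using Union_mono[OF \<open>\<V> \<subseteq> \<U>\<close>] by (simp add: cov)
    show "topspace (chain_space \<L>) \<subseteq> \<Union>\<V>"
      using \<open>upto UNIV \<subseteq> \<Union>\<V>\<close> by (simp add: upto_def)
  qed
  ultimately show "\<exists>\<V>. countable \<V> \<and> \<V> \<subseteq> \<U> \<and> \<Union>\<V> = topspace (chain_space \<L>)"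
    by blast
qed

text \<open>The diagonal \<open>F = {((f, L), f). f \<notin> L}\<close> is closed, since equality of two continuous maps
  into a Hausdorff space is a closed condition. Its points have a level other than \<open>\<omega>\<^sup>\<omega>\<close>, so
  initial segments bounded by proper levels cover it, and every proper level occurs in it.\<close>

lemma (in michael_chain) not_Lindelof_space_chain_space_times_baire:
  "\<not> Lindelof_space (prod_topology (chain_space \<L>) baire_space)" (is "\<not> Lindelof_space ?P")
proof
  assume "Lindelof_space ?P"
  define F where "F = {p \<in> topspace ?P. fst (fst p) = emb (snd p)}"
  have cs: "continuous_map (chain_space \<L>) euclidean fst"
       "continuous_map (chain_space \<L>) down_topology snd"
    unfolding chain_space_def
    by (auto intro: continuous_map_from_subtopology continuous_map_fst continuous_map_snd)
  have "closedin ?P F"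
    unfolding F_def
  proof (rule closedin_continuous_maps_eq)
    have "Hausdorff_space (euclidean :: enat topology)"
      by (auto simp: Hausdorff_space_def disjnt_def) (metis hausdorff)
    then have "Hausdorff_space (product_topology (\<lambda>_::nat. euclidean :: enat topology) UNIV)"
      by (simp add: Hausdorff_space_product_topology)
    then show "Hausdorff_space (euclidean :: (nat \<Rightarrow> enat) topology)"
      by (simp add: euclidean_product_topology)
    show "continuous_map ?P euclidean (\<lambda>p. fst (fst p))"
      using continuous_map_compose[OF continuous_map_fst cs(1)] by (simp add: comp_def)
    show "continuous_map ?P euclidean (\<lambda>p. emb (snd p))"
      using continuous_map_compose[OF continuous_map_snd continuous_map_emb] by (simp add: comp_def)
  qed
  define below where "below = (\<lambda>M. {p \<in> topspace ?P. snd (fst p) \<subseteq> M})"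
  have below: "openin ?P (below M)" for M
  proof -
    have "continuous_map ?P down_topology (\<lambda>p. snd (fst p))"
      using continuous_map_compose[OF continuous_map_fst cs(2)] by (simp add: comp_def)
    moreover have "openin down_topology {L. L \<subseteq> M}"
      by (auto simp: openin_down_topology)
    ultimately show ?thesis
      unfolding below_def by (auto dest: openin_continuous_map_preimage)
  qed
  define \<U> where "\<U> = insert (topspace ?P - F) (below ` (\<L> - {UNIV}))"
  have "\<forall>U\<in>\<U>. openin ?P U"
    unfolding \<U>_def using below \<open>closedin ?P F\<close> by blast
  moreover have "\<Union>\<U> = topspace ?P"
  proof
    show "\<Union>\<U> \<subseteq> topspace ?P"
      by (auto simp: \<U>_def below_def)
    show "topspace ?P \<subseteq> \<Union>\<U>"
      by (force simp: \<U>_def below_def F_def)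
  qed
  ultimately obtain \<V> where V: "countable \<V>" "\<V> \<subseteq> \<U>" "\<Union>\<V> = topspace ?P"
    using \<open>Lindelof_space ?P\<close> unfolding Lindelof_space_def by meson
  have "\<V> - {topspace ?P - F} \<subseteq> below ` (\<L> - {UNIV})"
    using V(2) unfolding \<U>_def by blast
  with countable_Diff[OF V(1)]
  have "countable (\<V> - {topspace ?P - F}) \<and> \<V> - {topspace ?P - F} \<subseteq> below ` (\<L> - {UNIV})" ..
  then obtain \<C> where C: "\<C> \<subseteq> \<L> - {UNIV}" "countable \<C>" "\<V> - {topspace ?P - F} = below ` \<C>"
    unfolding countable_subset_image by (elim exE conjE)
  have "\<exists>C\<in>\<C>. L \<subseteq> C" if L: "L \<in> \<L> - {UNIV}" for L
  proof -
    from L obtain f where "f \<notin> L"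
      by blast
    then have p: "((emb f, L), f) \<in> F"
      using L by (auto simp: F_def)
    then have "((emb f, L), f) \<in> \<Union>\<V>"
      unfolding V(3) F_def by blast
    then have "((emb f, L), f) \<in> \<Union>(below ` \<C>)"
      using p C(3) by blast
    then show ?thesis
      by (auto simp: below_def)
  qed
  moreover have "\<C> \<subseteq> {L \<in> \<L>. L \<subset> UNIV}"
    using C(1) by auto
  ultimately have "countably_approached \<L> UNIV"
    unfolding countably_approached_def using C(2) by (intro exI[of _ \<C>]) auto
  then show False
    using not_approached by simp
qed

text \<open>The injection is a homeomorphism onto its range with the topology pulled back along its
  inverse.\<close>

lemma michael_space_transport:
  fixes X :: "'a topology" and code :: "'a \<Rightarrow> 'b"
  assumes inj: "inj code" and X: "michael_space X"
  shows "\<exists>Y :: 'b topology. michael_space Y"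
proof -
  define Y where "Y = pullback_topology (range code) (inv code) X"
  have top_Y: "topspace Y = code ` topspace X"
    using inj by (auto simp: Y_def topspace_pullback_topology)
  have "continuous_map X Y code"
    unfolding Y_def
    by (rule continuous_map_pullback') (use inj in \<open>auto simp: comp_def\<close>)
  then have "Lindelof_space Y"
    using Lindelof_space_continuous_map_image[of X Y code] X top_Y by (simp add: michael_space_def)
  moreover have "\<not> Lindelof_space (prod_topology Y baire_space)"
  proof
    assume L: "Lindelof_space (prod_topology Y baire_space)"
    have cY: "continuous_map Y X (inv code)"
      unfolding Y_def using continuous_map_pullback[of X X id] by (simp add: comp_def id_def)
    have "continuous_map (prod_topology Y baire_space) (prod_topology X baire_space)
            (\<lambda>(y, f). (inv code y, f))"
      using cY by (simp add: continuous_map_prod_top)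
    moreover have "(\<lambda>(y, f). (inv code y, f)) ` topspace (prod_topology Y baire_space)
        = topspace (prod_topology X baire_space)"
      using inj by (force simp: top_Y image_iff)
    ultimately have "Lindelof_space (prod_topology X baire_space)"
      by (rule Lindelof_space_continuous_map_image[OF L])
    then show False
      using X by (simp add: michael_space_def)
  qed
  ultimately show ?thesis
    unfolding michael_space_def by blast
qed

text \<open>The points of the space are coded as sets of functions, with an initial value that tags
  the coordinate: 0 for the point of \<open>(\<omega>+1)\<^sup>\<omega>\<close>, 1 for the members of the level.\<close>

lemma inj_code: "inj (\<lambda>(z :: nat \<Rightarrow> enat, L :: (nat \<Rightarrow> nat) set).
    insert (case_nat (0::nat) (to_nat \<circ> z)) (case_nat 1 ` L))"
proof (rule injI, clarify)
  fix z z' :: "nat \<Rightarrow> enat" and L L' :: "(nat \<Rightarrow> nat) set"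
  assume eq: "insert (case_nat (0::nat) (to_nat \<circ> z)) (case_nat 1 ` L)
     = insert (case_nat 0 (to_nat \<circ> z')) (case_nat 1 ` L')"
  have head: "case_nat (0::nat) f \<noteq> case_nat 1 g" for f g :: "nat \<Rightarrow> nat"
    by (metis old.nat.simps(4) zero_neq_one)
  have tail: "case_nat i f = case_nat i g \<longleftrightarrow> f = g" for i :: nat and f g :: "nat \<Rightarrow> nat"
    by (metis (no_types) ext old.nat.simps(5))
  have "case_nat 0 (to_nat \<circ> z) = case_nat 0 (to_nat \<circ> z')"
    using eq head by blast
  then have "to_nat \<circ> z = to_nat \<circ> z'"
    by (simp only: tail)
  then have "z = z'"
    by (simp add: fun_eq_iff)
  moreover have "f \<in> L \<longleftrightarrow> f \<in> L'" for f
  proof -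
    have "f \<in> L \<longleftrightarrow> case_nat 1 f \<in> insert (case_nat 0 (to_nat \<circ> z)) (case_nat 1 ` L)"
      using head[symmetric] by (auto simp only: tail insert_iff image_iff)
    also have "\<dots> \<longleftrightarrow> f \<in> L'"
      unfolding eq using head[symmetric] by (auto simp only: tail insert_iff image_iff)
    finally show ?thesis .
  qed
  ultimately show "z = z' \<and> L = L'"
    by auto
qed

section \<open>The chain of a Michael ultrafilter\<close>

lemma le_mod_refl: "le_mod U f f"
  by (simp add: le_mod_def)

lemma le_mod_trans: "le_mod U f g \<Longrightarrow> le_mod U g h \<Longrightarrow> le_mod U f h"
  unfolding le_mod_def by (erule (1) eventually_elim2) simp

lemma le_mod_total:
  assumes "nonprincipal_ultrafilter U"
  shows "le_mod U f g \<or> le_mod U g f"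
proof -
  have "eventually (\<lambda>n. f n \<le> g n) U \<or> eventually (\<lambda>n. \<not> f n \<le> g n) U"
    using assms unfolding nonprincipal_ultrafilter_def by blast
  moreover have "eventually (\<lambda>n. g n \<le> f n) U" if "eventually (\<lambda>n. \<not> f n \<le> g n) U"
    using that by (rule eventually_mono) simp
  ultimately show ?thesis
    unfolding le_mod_def by blast
qed

text \<open>An ultrafilter containing a singleton would be principal, so this one contains the
  complements of singletons, hence all cofinite sets.\<close>

lemma eventually_ge_nonprincipal:
  assumes "nonprincipal_ultrafilter U"
  shows "eventually (\<lambda>n. m \<le> n) U"
proof -
  have "eventually (\<lambda>n. n \<noteq> k) U" for k
  proof (rule ccontr)
    assume "\<not> eventually (\<lambda>n. n \<noteq> k) U"
    with assms have k: "eventually (\<lambda>n. n = k) U"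
      unfolding nonprincipal_ultrafilter_def by fastforce
    have bot: "U \<noteq> bot"
      using assms unfolding nonprincipal_ultrafilter_def by blast
    have "eventually P U \<longleftrightarrow> P k" for P
    proof
      assume "eventually P U"
      with k have "eventually (\<lambda>n. P k) U"
        by (rule eventually_elim2) simp
      with bot show "P k"
        by simp
    next
      assume "P k"
      with k show "eventually P U"
        by (auto elim: eventually_mono)
    qed
    then have "U = principal {k}"
      by (simp add: filter_eq_iff eventually_principal)
    with assms show False
      unfolding nonprincipal_ultrafilter_def by blast
  qed
  then have "eventually (\<lambda>n. \<forall>k\<in>{..<m}. n \<noteq> k) U"
    by (simp add: eventually_ball_finite_distrib)
  then show ?thesis
    by (rule eventually_mono) (auto simp: not_less)
qed

text \<open>Diagonalization: the function whose value at \<open>n\<close> is the sum of the values at \<open>n\<close> of the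
  first \<open>n + 1\<close> members of \<open>F\<close> bounds each member from its own index on.\<close>

lemma countable_bounded_mod:
  assumes U: "nonprincipal_ultrafilter U" and "countable F"
  shows "\<exists>h. \<forall>f\<in>F. le_mod U f h"
proof (cases "F = {}")
  case True
  then show ?thesis by blast
next
  case False
  with \<open>countable F\<close> obtain e :: "nat \<Rightarrow> nat \<Rightarrow> nat" where e: "range e = F"
    by (metis range_from_nat_into)
  define h where "h = (\<lambda>n. \<Sum>i\<le>n. e i n)"
  have "le_mod U (e i) h" for i
    unfolding le_mod_def
    by (rule eventually_mono[OF eventually_ge_nonprincipal[OF U, of i]])
       (auto simp: h_def intro: member_le_sum)
  then show ?thesis
    using e by blast
qed

lemma compactin_baire_space_bounded:
  assumes "compactin baire_space K"
  obtains h where "\<And>f. f \<in> K \<Longrightarrow> f \<le> h"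
proof -
  have fin: "finite ((\<lambda>f. f n) ` K)" for n
  proof -
    have "continuous_map baire_space (discrete_topology UNIV) (\<lambda>f. f n)"
      unfolding baire_space_def by (rule continuous_map_product_projection) simp
    then have "compactin (discrete_topology UNIV) ((\<lambda>f. f n) ` K)"
      using assms image_compactin by blast
    then show ?thesis
      by (simp add: compactin_discrete_topology)
  qed
  show thesis
  proof (rule that)
    show "f \<le> (\<lambda>n. Max ((\<lambda>f. f n) ` K))" if "f \<in> K" for f
      using that fin by (auto simp: le_fun_def)
  qed
qed

text \<open>The levels are \<open>X \<xi>\<close>, for \<open>\<xi>\<close> in a least cofinal set \<open>D\<close>, and \<open>\<omega>\<^sup>\<omega>\<close>. All of them are
  closed downwards modulo \<open>U\<close>, so a set bounded by one function is contained in the levels that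
  contain this function. This reduces bounded sets to single functions: if no level below \<open>L\<close>
  contains \<open>k \<in> L\<close>, the levels below \<open>L\<close> have a greatest element, namely \<open>X \<eta>\<close> for the first
  bound \<open>\<eta>\<close> of \<open>k\<close> in \<open>D\<close>.\<close>

lemma michael_chain_of_ultrafilter:
  assumes "michael_ultrafilter U"
  shows "\<exists>\<L>. michael_chain \<L>"
proof -
  have U: "nonprincipal_ultrafilter U"
    and mich: "\<And>K. compactin baire_space K \<Longrightarrow> natLeq <o cof U K \<Longrightarrow> cof U UNIV \<le>o cof U K"
    using assms unfolding michael_ultrafilter_def by blast+
  obtain D where D: "cofinal_mod U UNIV D" and cofD: "cof U UNIV = |D|"
    using cof_attained by blast
  define r where "r = |D|"
  have card: "Card_order r" and field: "Field r = D"
    unfolding r_def by (rule card_of_Card_order, rule Field_card_of)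
  have wo: "wo_rel r"
    using card by (simp add: wo_rel_def card_order_on_def)
  have dom: "\<exists>d\<in>D. le_mod U f d" for f
    using D unfolding cofinal_mod_def by blast
  have "infinite D"
  proof
    assume "finite D"
    then obtain h where h: "\<And>d. d \<in> D \<Longrightarrow> le_mod U d h"
      using countable_bounded_mod[OF U countable_finite] by blast
    obtain d where "d \<in> D" "le_mod U (\<lambda>n. Suc (h n)) d"
      using dom by blast
    then have "le_mod U (\<lambda>n. Suc (h n)) h"
      using h le_mod_trans by blast
    then show False
      using U by (simp add: le_mod_def nonprincipal_ultrafilter_def)
  qed
  define X where "X = (\<lambda>\<xi>. {f. \<exists>\<eta>\<in>underS r \<xi>. le_mod U f \<eta>})"
  define \<L> where "\<L> = insert UNIV (X ` D)"
  have down: "f \<in> L" if "L \<in> \<L>" "g \<in> L" "le_mod U f g" for f g L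
    using that le_mod_trans unfolding \<L>_def X_def by blast
  have X_mono: "X \<xi> \<subseteq> X \<zeta>" if "(\<xi>, \<zeta>) \<in> r" for \<xi> \<zeta>
    using underS_incr[OF wo_rel.TRANS[OF wo] wo_rel.ANTISYM[OF wo] that] unfolding X_def by blast
  have X_proper: "X \<xi> \<noteq> UNIV" if "\<xi> \<in> D" for \<xi>
  proof
    assume "X \<xi> = UNIV"
    moreover have "underS r \<xi> \<subseteq> D"
      using underS_Field[of _ r \<xi>] field by blast
    ultimately have "cofinal_mod U UNIV (underS r \<xi>)"
      unfolding cofinal_mod_def X_def by blast
    then have "|D| \<le>o |underS r \<xi>|"
      using cof_least cofD by metis
    moreover have "|underS r \<xi>| <o |D|"
      using card_of_underS[OF card] that field r_def by metis
    ultimately show False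
      using not_ordLess_ordLeq by blast
  qed
  \<comment> \<open>\<open>\<omega>\<^sup>\<omega>\<close> is the union of the \<open>X \<xi>\<close>: an infinite cardinal has no greatest element, so every
     bound \<open>d\<close> is followed by some \<open>\<xi>\<close>.\<close>
  have in_X: "\<exists>\<xi>\<in>D. f \<in> X \<xi>" for f
  proof -
    obtain d where d: "d \<in> D" "le_mod U f d"
      using dom by blast
    obtain \<xi> where "\<xi> \<in> D" "d \<noteq> \<xi>" "(d, \<xi>) \<in> r"
      using infinite_Card_order_limit[OF card] \<open>infinite D\<close> d(1) field by metis
    then show ?thesis
      using d(2) unfolding X_def underS_def by blast
  qed
  have least: "\<exists>L\<in>A. \<forall>L'\<in>A. L \<subseteq> L'" if A: "A \<subseteq> \<L>" "A \<noteq> {}" for A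
  proof (cases "\<exists>\<xi>\<in>D. X \<xi> \<in> A")
    case True
    define B where "B = {\<xi> \<in> D. X \<xi> \<in> A}"
    have "B \<subseteq> Field r" "B \<noteq> {}"
      using True field unfolding B_def by blast+
    then have min: "wo_rel.minim r B \<in> B" "\<And>\<xi>. \<xi> \<in> B \<Longrightarrow> (wo_rel.minim r B, \<xi>) \<in> r"
      using wo_rel.minim_in[OF wo] wo_rel.minim_least[OF wo] by blast+
    show ?thesis
    proof (intro bexI ballI)
      show "X (wo_rel.minim r B) \<in> A"
        using min(1) unfolding B_def by blast
      fix L' assume L': "L' \<in> A"
      show "X (wo_rel.minim r B) \<subseteq> L'"
      proof (cases "L' = UNIV")
        case False
        then obtain \<xi> where "\<xi> \<in> D" "L' = X \<xi>"
          using L' A(1) unfolding \<L>_def by blast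
        then show ?thesis
          using L' X_mono[OF min(2)] unfolding B_def by blast
      qed simp
    qed
  next
    case False
    then show ?thesis
      using A unfolding \<L>_def by blast
  qed
  have point: "(\<exists>L'\<in>\<L>. L' \<subset> L \<and> k \<in> L') \<or> countably_approached \<L> L" if L: "L \<in> \<L>" "k \<in> L" for k L
  proof (rule disjCI)
    assume np: "\<not> countably_approached \<L> L"
    define B where "B = {\<eta> \<in> D. le_mod U k \<eta>}"
    have "B \<subseteq> Field r" "B \<noteq> {}"
      using dom field unfolding B_def by blast+
    define \<eta> where "\<eta> = wo_rel.minim r B"
    have \<eta>: "\<eta> \<in> B" "\<And>\<xi>. \<xi> \<in> B \<Longrightarrow> (\<eta>, \<xi>) \<in> r"
      using \<open>B \<subseteq> Field r\<close> \<open>B \<noteq> {}\<close> wo_rel.minim_in[OF wo] wo_rel.minim_least[OF wo] unfolding \<eta>_def by blast+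
    have "k \<notin> X \<eta>"
    proof
      assume "k \<in> X \<eta>"
      then obtain \<zeta> where z: "\<zeta> \<noteq> \<eta>" "(\<zeta>, \<eta>) \<in> r" "le_mod U k \<zeta>"
        unfolding X_def underS_def by blast
      then have "\<zeta> \<in> B"
        using field unfolding B_def by (auto simp: Field_def)
      then show False
        using \<eta>(2) z wo_rel.ANTISYM[OF wo] by (meson antisymD)
    qed
    have X\<eta>: "X \<eta> \<in> \<L>"
      using \<eta>(1) unfolding B_def \<L>_def by blast
    \<comment> \<open>If \<open>\<eta>\<close> came before \<open>\<xi>\<close>, then \<open>k\<close> would be in \<open>X \<xi>\<close>.\<close>
    have below: "L' \<subseteq> X \<eta>" if L': "L' \<in> \<L>" "k \<notin> L'" for L'
    proof -
      obtain \<xi> where \<xi>: "\<xi> \<in> D" "L' = X \<xi>"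
        using L' unfolding \<L>_def by blast
      have "(\<xi>, \<eta>) \<in> r"
      proof (rule ccontr)
        assume "(\<xi>, \<eta>) \<notin> r"
        then have "\<eta> \<in> underS r \<xi>"
          using wo_rel.TOTALS[OF wo] \<xi>(1) \<eta>(1) field wo_rel.REFL[OF wo] unfolding underS_def B_def
          by (auto dest: refl_onD)
        then show False
          using L'(2) \<eta>(1) unfolding \<xi>(2) X_def B_def by blast
      qed
      then show ?thesis
        using X_mono \<xi>(2) by blast
    qed
    show "\<exists>L'\<in>\<L>. L' \<subset> L \<and> k \<in> L'"
    proof (rule ccontr)
      assume no: "\<not> (\<exists>L'\<in>\<L>. L' \<subset> L \<and> k \<in> L')"
      have "X \<eta> \<subset> L"
        using least[of "{X \<eta>, L}"] X\<eta> L \<open>k \<notin> X \<eta>\<close> by auto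
      moreover have "L' \<subseteq> X \<eta>" if "L' \<in> \<L>" "L' \<subset> L" for L'
        using no that below by blast
      ultimately have "countably_approached \<L> L"
        unfolding countably_approached_def using X\<eta> by (intro exI[of _ "{X \<eta>}"]) auto
      with np show False ..
    qed
  qed
  have bounded: "(\<exists>L'\<in>\<L>. L' \<subset> L \<and> K \<subseteq> L') \<or> countably_approached \<L> L"
    if "L \<in> \<L>" "h \<in> L" "\<And>f. f \<in> K \<Longrightarrow> le_mod U f h" for L K h
    using point[OF that(1,2)] that(3) down by blast
  have compact: "(\<exists>L'\<in>\<L>. L' \<subset> L \<and> K \<subseteq> L') \<or> countably_approached \<L> L"
    if L: "L \<in> \<L>" and K: "compactin baire_space K" "K \<subseteq> L" for L K
  proof (cases "natLeq <o cof U K")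
    case False
    \<comment> \<open>With \<open>E\<close> countable and cofinal in \<open>K\<close>, a level that contains \<open>E\<close> contains \<open>K\<close>.\<close>
    obtain E where E: "cofinal_mod U K E" "cof U K = |E|"
      using cof_attained by blast
    have "|E| \<le>o natLeq"
      using False E(2) by (metis card_of_Well_order natLeq_Well_order not_ordLess_iff_ordLeq)
    then have "countable E"
      by (simp add: countable_card_le_natLeq)
    show ?thesis
    proof (rule disjCI)
      assume np: "\<not> countably_approached \<L> L"
      have "E \<subseteq> L"
        using E(1) K(2) unfolding cofinal_mod_def by blast
      then have "\<forall>k\<in>E. \<exists>L'\<in>\<L>. L' \<subset> L \<and> k \<in> L'"
        using point[OF L] np by blast
      then obtain m where m: "\<And>k. k \<in> E \<Longrightarrow> m k \<in> \<L> \<and> m k \<subset> L \<and> k \<in> m k"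
        by metis
      have "\<not> (\<forall>L'\<in>\<L>. L' \<subset> L \<longrightarrow> (\<exists>C\<in>m ` E. L' \<subseteq> C))"
      proof
        assume *: "\<forall>L'\<in>\<L>. L' \<subset> L \<longrightarrow> (\<exists>C\<in>m ` E. L' \<subseteq> C)"
        have "m ` E \<subseteq> {L'\<in>\<L>. L' \<subset> L}"
          using m by auto
        moreover have "countable (m ` E)"
          using \<open>countable E\<close> by simp
        ultimately have "countably_approached \<L> L"
          unfolding countably_approached_def using * by (intro exI[of _ "m ` E"] conjI)
        with np show False ..
      qed
      then obtain L' where L': "L' \<in> \<L>" "L' \<subset> L" "\<And>k. k \<in> E \<Longrightarrow> \<not> L' \<subseteq> m k"
        by blast
      have "E \<subseteq> L'"
      proof
        fix k assume k: "k \<in> E"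
        have "L' \<subseteq> m k \<or> m k \<subseteq> L'"
          using least[of "{L', m k}"] L'(1) m[OF k] by simp
        then show "k \<in> L'"
          using L'(3) m k by blast
      qed
      then have "K \<subseteq> L'"
        using E(1) down[OF L'(1)] unfolding cofinal_mod_def by blast
      then show "\<exists>L'\<in>\<L>. L' \<subset> L \<and> K \<subseteq> L'"
        using L' by blast
    qed
  next
    case True
    then have large: "|D| \<le>o cof U K"
      using mich[OF K(1)] cofD by simp
    show ?thesis
    proof (cases "L = UNIV")
      case True
      obtain h where "\<And>f. f \<in> K \<Longrightarrow> f \<le> h"
        using compactin_baire_space_bounded[OF K(1)] by blast
      then have "\<And>f. f \<in> K \<Longrightarrow> le_mod U f h"
        by (simp add: le_mod_def le_fun_def)
      then show ?thesis
        using bounded[OF L, of h K] True by blast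
    next
      case False
      then obtain \<xi> where \<xi>: "\<xi> \<in> D" "L = X \<xi>"
        using L unfolding \<L>_def by blast
      show ?thesis
      proof (rule ccontr)
        assume no: "\<not> ?thesis"
        \<comment> \<open>Each \<open>\<eta>\<close> before \<open>\<xi>\<close> belongs to \<open>X \<xi>\<close> and so cannot bound \<open>K\<close>. The members of \<open>K\<close>
           above these \<open>\<eta>\<close> are then cofinal in \<open>K\<close>, and they are too few.\<close>
        have "\<exists>k\<in>K. le_mod U \<eta> k" if "\<eta> \<in> underS r \<xi>" for \<eta>
        proof -
          have "\<eta> \<in> L"
            using that le_mod_refl unfolding \<xi>(2) X_def by blast
          then have "\<exists>k\<in>K. \<not> le_mod U k \<eta>"
            using bounded[OF L, of \<eta> K] no by blast
          then show ?thesis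
            using le_mod_total[OF U] by blast
        qed
        then obtain k where k: "\<And>\<eta>. \<eta> \<in> underS r \<xi> \<Longrightarrow> k \<eta> \<in> K \<and> le_mod U \<eta> (k \<eta>)"
          by metis
        have "cofinal_mod U K (k ` underS r \<xi>)"
          unfolding cofinal_mod_def
        proof (intro conjI ballI)
          show "k ` underS r \<xi> \<subseteq> K"
            using k by blast
          fix f assume "f \<in> K"
          then obtain \<eta> where "\<eta> \<in> underS r \<xi>" "le_mod U f \<eta>"
            using K(2) unfolding \<xi>(2) X_def by blast
          then show "\<exists>g\<in>k ` underS r \<xi>. le_mod U f g"
            using k le_mod_trans by blast
        qed
        then have "cof U K \<le>o |k ` underS r \<xi>|"
          by (rule cof_least)
        also have "|k ` underS r \<xi>| \<le>o |underS r \<xi>|"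
          by (rule card_of_image)
        also have "|underS r \<xi>| <o |D|"
          using card_of_underS[OF card] \<xi>(1) field r_def by metis
        finally show False
          using large not_ordLess_ordLeq by blast
      qed
    qed
  qed
  have not_approached: "\<not> countably_approached \<L> UNIV"
  proof
    assume "countably_approached \<L> UNIV"
    then obtain \<C> where C: "\<C> \<subseteq> {L\<in>\<L>. L \<subset> UNIV}" "countable \<C>"
        "\<forall>L'\<in>\<L>. L' \<subset> UNIV \<longrightarrow> (\<exists>C\<in>\<C>. L' \<subseteq> C)"
      unfolding countably_approached_def by (elim exE conjE)
    \<comment> \<open>A function above one non-member of each \<open>C\<close> lies in some \<open>X \<xi>\<close>, which then fits into
       no \<open>C\<close>, because levels are closed downwards.\<close>
    then have "\<forall>C\<in>\<C>. \<exists>f. f \<notin> C"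
      by blast
    then obtain m where m: "\<And>C. C \<in> \<C> \<Longrightarrow> m C \<notin> C"
      by metis
    obtain h where h: "\<And>f. f \<in> m ` \<C> \<Longrightarrow> le_mod U f h"
      using countable_bounded_mod[OF U countable_image[OF C(2), of m]] by blast
    obtain \<xi> where "\<xi> \<in> D" "h \<in> X \<xi>"
      using in_X by blast
    then have "X \<xi> \<in> \<L>" "X \<xi> \<subset> UNIV"
      using X_proper by (auto simp: \<L>_def)
    then obtain C where "C \<in> \<C>" "X \<xi> \<subseteq> C"
      using C(3) by blast
    moreover from this have "m C \<in> C"
      using down[of C h "m C"] h C(1) \<open>h \<in> X \<xi>\<close> by blast
    ultimately show False
      using m by blast
  qed
  have "UNIV \<in> \<L>"
    by (simp add: \<L>_def)
  then have "michael_chain \<L>"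
    using least compact not_approached by unfold_locales
  then show ?thesis ..
qed

theorem theorem1p2:
  assumes "\<exists>U. michael_ultrafilter U"
  shows "\<exists>X :: (nat \<Rightarrow> nat) set topology. michael_space X"
proof -
  obtain \<L> where L: "michael_chain \<L>"
    using assms michael_chain_of_ultrafilter by blast
  have "michael_space (chain_space \<L>)"
    unfolding michael_space_def
    using michael_chain.Lindelof_space_chain_space[OF L]
      michael_chain.not_Lindelof_space_chain_space_times_baire[OF L] by blast
  then show ?thesis
    using michael_space_transport[OF inj_code] by blast
qed

end
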